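(* Let $G^\sigma$ be an oriented hypergraph whose underlying hypergraph $G$ is connected. Then the following are equivalent: (1) $G^\sigma$ is incidence balanced; (2) $\lambda_{\max}(M(G^+))$ is a singular value of $M(G^\sigma)$; (3) $\rho(L(G^+))$ is an eigenvalue of $L(G^\sigma)$; (4) $\rho(A(G^+))$ is an eigenvalue of $A(G^\sigma)$.
   Context: A hypergraph $G$ has a finite vertex set $V(G)$ and edge set $E(G)$ of subsets of $V(G)$; it is connected if any two elements of $V(G)\cup E(G)$ are joined by a walk (an alternating sequence of vertices and edges in which consecutive elements are incident). An incidence is a pair $(e,v)$ with $v\in e$; $d_v$ is the number of incidences containing $v$. An oriented hypergraph $G^\sigma$ is $G$ with a map $\sigma$ from incidences to $\{-1,1\}$; $G^+$ is the one with $\sigma\equiv1$. $G^\sigma$ is incidence balanced if there is a bipartition $\{X,Y\}$ of $V(G)$ (one part possibly empty) such that for every edge $e$, either $\sigma(e,v)=1$ for all $v\in e\cap X$ and $\sigma(e,v)=-1$ for all $v\in e\cap Y$, or $\sigma(e,v)=-1$ for all $v\in e\cap X$ and $\sigma(e,v)=1$ for all $v\in e\cap Y$. $M(G^\sigma)$ is the $E(G)\times V(G)$ matrix with entry $\sigma(e,v)$ if $v\in e$ and $0$ otherwise; $\lambda_{\max}(M)$ is the largest singular value of $M$. $A(G^\sigma)=(a^\sigma_{uv})$ is the $V(G)\times V(G)$ matrix with $a^\sigma_{uv}=\sum_{e:\,u,v\in e}\sigma(e,u)\sigma(e,v)$ for distinct adjacent $u,v$ and $0$ otherwise; $L(G^\sigma)=D(G)+A(G^\sigma)$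 with $D(G)=\mathrm{diag}\{d_v\}$. $\rho(\cdot)$ is the spectral radius. *)

theory Defs
  imports "Jordan_Normal_Form.Spectral_Radius"
begin

definition hypergraph :: "'a set \<Rightarrow> 'a set set \<Rightarrow> bool" where
  "hypergraph V E \<longleftrightarrow> finite V \<and> (\<forall>e\<in>E. e \<subseteq> V)"

text \<open>Walks are lists over the disjoint sum of vertices and edges; they may start and end
  with either kind of element, and a single element is a walk.\<close>

fun incident :: "'a + 'a set \<Rightarrow> 'a + 'a set \<Rightarrow> bool" where
  "incident (Inl v) (Inr e) \<longleftrightarrow> v \<in> e"
| "incident (Inr e) (Inl v) \<longleftrightarrow> v \<in> e"
| "incident (Inl u) (Inl v) \<longleftrightarrow> False"
| "incident (Inr e) (Inr f) \<longleftrightarrow> False"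

definition walk :: "'a set \<Rightarrow> 'a set set \<Rightarrow> ('a + 'a set) list \<Rightarrow> bool" where
  "walk V E p \<longleftrightarrow> p \<noteq> [] \<and> set p \<subseteq> V <+> E \<and> successively incident p"

definition connected_hypergraph :: "'a set \<Rightarrow> 'a set set \<Rightarrow> bool" where
  "connected_hypergraph V E \<longleftrightarrow>
    (\<forall>x\<in>V <+> E. \<forall>y\<in>V <+> E. \<exists>p. walk V E p \<and> hd p = x \<and> last p = y)"

definition incidences :: "'a set set \<Rightarrow> ('a set \<times> 'a) set" where
  "incidences E = {(e, v). e \<in> E \<and> v \<in> e}"

definition vertex_degree :: "'a set set \<Rightarrow> 'a \<Rightarrow> nat" where
  "vertex_degree E v = card {i \<in> incidences E. snd i = v}"

text \<open>An orientation is a total function; only its values on incidences are constrained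
  and only these are used below.\<close>

definition oriented_hypergraph ::
    "'a set \<Rightarrow> 'a set set \<Rightarrow> ('a set \<times> 'a \<Rightarrow> real) \<Rightarrow> bool" where
  "oriented_hypergraph V E \<sigma> \<longleftrightarrow> hypergraph V E \<and> (\<forall>i\<in>incidences E. \<sigma> i \<in> {-1, 1})"

definition all_positive :: "'a set \<times> 'a \<Rightarrow> real" where
  "all_positive = (\<lambda>_. 1)"

definition incidence_balanced ::
    "'a set \<Rightarrow> 'a set set \<Rightarrow> ('a set \<times> 'a \<Rightarrow> real) \<Rightarrow> bool" where
  "incidence_balanced V E \<sigma> \<longleftrightarrow>
    (\<exists>X Y. X \<union> Y = V \<and> X \<inter> Y = {} \<and>
      (\<forall>e\<in>E.
        ((\<forall>v\<in>e \<inter> X. \<sigma> (e, v) = 1) \<and> (\<forall>v\<in>e \<inter> Y. \<sigma> (e, v) = -1)) \<or>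
        ((\<forall>v\<in>e \<inter> X. \<sigma> (e, v) = -1) \<and> (\<forall>v\<in>e \<inter> Y. \<sigma> (e, v) = 1))))"

text \<open>Matrices in the library are indexed by numbers. The matrices indexed by vertices and
  edges are therefore taken with respect to enumerations of the vertices and the edges, that is,
  duplicate-free lists \<open>vs\<close> and \<open>es\<close> with \<open>set vs = V\<close> and \<open>set es = E\<close>.\<close>

definition incidence_matrix ::
    "'a list \<Rightarrow> 'a set list \<Rightarrow> ('a set \<times> 'a \<Rightarrow> real) \<Rightarrow> real mat" where
  "incidence_matrix vs es \<sigma> =
    mat (length es) (length vs)
      (\<lambda>(i, j). if vs ! j \<in> es ! i then \<sigma> (es ! i, vs ! j) else 0)"

definition adjacent :: "'a set set \<Rightarrow> 'a \<Rightarrow> 'a \<Rightarrow> bool" where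
  "adjacent E u v \<longleftrightarrow> (\<exists>e\<in>E. u \<in> e \<and> v \<in> e)"

definition adjacency_entry ::
    "'a set set \<Rightarrow> ('a set \<times> 'a \<Rightarrow> real) \<Rightarrow> 'a \<Rightarrow> 'a \<Rightarrow> real" where
  "adjacency_entry E \<sigma> u v =
    (if u \<noteq> v \<and> adjacent E u v
     then \<Sum>e | e \<in> E \<and> u \<in> e \<and> v \<in> e. \<sigma> (e, u) * \<sigma> (e, v) else 0)"

definition adjacency_matrix ::
    "'a list \<Rightarrow> 'a set set \<Rightarrow> ('a set \<times> 'a \<Rightarrow> real) \<Rightarrow> real mat" where
  "adjacency_matrix vs E \<sigma> =
    mat (length vs) (length vs) (\<lambda>(i, j). adjacency_entry E \<sigma> (vs ! i) (vs ! j))"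

definition degree_matrix :: "'a list \<Rightarrow> 'a set set \<Rightarrow> real mat" where
  "degree_matrix vs E = mat_diag (length vs) (\<lambda>i. real (vertex_degree E (vs ! i)))"

definition laplacian_matrix ::
    "'a list \<Rightarrow> 'a set set \<Rightarrow> ('a set \<times> 'a \<Rightarrow> real) \<Rightarrow> real mat" where
  "laplacian_matrix vs E \<sigma> = degree_matrix vs E + adjacency_matrix vs E \<sigma>"

text \<open>The singular values of \<open>M\<close> are the nonnegative square roots of the eigenvalues of
  \<open>M\<^sup>T M\<close>; in particular a matrix with at least one column and no rows has singular value 0.\<close>

definition singular_values :: "real mat \<Rightarrow> real set" where
  "singular_values M = {s. 0 \<le> s \<and> eigenvalue (transpose_mat M * M) (s\<^sup>2)}"

definition max_singular_value :: "real mat \<Rightarrow> real" where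
  "max_singular_value M = Max (singular_values M)"

definition real_spectral_radius :: "real mat \<Rightarrow> real" where
  "real_spectral_radius M = spectral_radius (map_mat complex_of_real M)"

end

theory Submission
  imports Defs "HOL-Analysis.Function_Topology"
begin

text \<open>For a symmetric nonnegative matrix \<open>B\<close> the spectral radius \<open>\<rho>\<close> is the maximum of the Rayleigh
  quotient, and every maximizer is an eigenvector. Let \<open>\<bar>C\<bar> \<le> B\<close> entrywise. If \<open>C x = \<rho> x\<close>, the
  triangle inequality makes \<open>\<bar>x\<bar>\<close> a maximizer for \<open>B\<close>; when \<open>B\<close> is irreducible, \<open>\<bar>x\<bar>\<close> is then positive
  and equality holds in every term, so that \<open>C = S B S\<close> with \<open>S\<close> the diagonal matrix of the signs
  of \<open>x\<close>. The converse is clear, \<open>C\<close> and \<open>B\<close> being similar.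

  For \<open>C = A(G\<^sup>\<sigma>)\<close> and \<open>B = A(G\<^sup>+)\<close>, an entry of \<open>B\<close> counts the edges through \<open>u\<close> and \<open>v\<close>, and the
  corresponding entry of \<open>C\<close> adds signs over these edges. Hence \<open>C = S B S\<close> forces
  \<open>\<sigma>(e,u) \<sigma>(e,v) = s\<^sub>u s\<^sub>v\<close> for every such \<open>e\<close>, which is incidence balance for the bipartition by the sign
  of \<open>s\<close>. The Laplacians differ from \<open>A\<close> only by the common diagonal, and \<open>L = M\<^sup>T M\<close> settles the
  singular values.\<close>

section \<open>Products and scalar products in coordinates\<close>

lemma mult_mat_vec_index_sum:
  assumes "A \<in> carrier_mat n n" "x \<in> carrier_vec n" "i < n"
  shows "(A *\<^sub>v x) $ i = (\<Sum>j<n. A $$ (i, j) * x $ j)"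
  using assms by (auto simp: scalar_prod_def atLeast0LessThan intro!: sum.cong)

lemma scalar_prod_sum:
  "y \<in> carrier_vec n \<Longrightarrow> x \<bullet> y = (\<Sum>i<n. x $ i * y $ i)"
  by (simp add: scalar_prod_def atLeast0LessThan)

lemma scalar_prod_self_eq_0_iff:
  fixes x :: "real vec"
  assumes "x \<in> carrier_vec n"
  shows "x \<bullet> x = 0 \<longleftrightarrow> x = 0\<^sub>v n"
proof
  assume "x \<bullet> x = 0"
  then have "\<forall>i<n. x $ i = 0"
    by (simp add: scalar_prod_sum[OF assms] sum_nonneg_eq_0_iff)
  with assms show "x = 0\<^sub>v n" by auto
qed (use assms in auto)

lemma scalar_prod_self_pos:
  fixes x :: "real vec"
  assumes "x \<in> carrier_vec n" "x \<noteq> 0\<^sub>v n"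
  shows "x \<bullet> x > 0"
  using scalar_prod_self_eq_0_iff[OF assms(1)] assms
  by (simp add: scalar_prod_sum[OF assms(1)] order_less_le sum_nonneg)

section \<open>Maxima of Rayleigh quotients\<close>

text \<open>The unit sphere of dimension \<open>n\<close> is modelled by functions on
  \<open>nat\<close> vanishing from \<open>n\<close> on, so that the product topology applies. It is
  a closed subset of a product of factors \<open>{-1..1}\<close> and \<open>{0}\<close>, which is
  compact by Tychonoff.\<close>

lemma compact_sphere:
  "compact {x :: nat \<Rightarrow> real. (\<forall>i\<ge>n. x i = 0) \<and> (\<Sum>i<n. x i * x i) = 1}" (is "compact ?S")
proof -
  let ?P = "\<Pi>\<^sub>E i\<in>UNIV. if i < n then {-1..1} else {0::real}"
  have "compactin (product_topology (\<lambda>i. euclidean) UNIV) ?P"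
    by (subst compactin_PiE) auto
  then have P: "compact ?P"
    by (simp add: euclidean_product_topology)
  have "closed {x :: nat \<Rightarrow> real. (\<Sum>i<n. x i * x i) = 1}"
    by (intro closed_Collect_eq continuous_intros) auto
  with P have "compact (?P \<inter> {x. (\<Sum>i<n. x i * x i) = 1})"
    by (rule compact_Int_closed)
  also have "?P \<inter> {x. (\<Sum>i<n. x i * x i) = 1} = ?S"
  proof (intro equalityI subsetI)
    fix x assume x: "x \<in> ?S"
    have "x i \<in> {-1..1}" if "i < n" for i
    proof -
      have "x i * x i \<le> (\<Sum>i<n. x i * x i)"
        by (rule member_le_sum) (use that in auto)
      with x have "(x i)\<^sup>2 \<le> 1" by (simp add: power2_eq_square)
      then show ?thesis by (auto simp: abs_square_le_1 abs_le_iff)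
    qed
    with x show "x \<in> ?P \<inter> {x. (\<Sum>i<n. x i * x i) = 1}"
      by (auto simp: PiE_def Pi_def not_less)
  next
    fix x assume "x \<in> ?P \<inter> {x. (\<Sum>i<n. x i * x i) = 1}"
    then have "\<forall>i. x i \<in> (if i < n then {-1..1} else {0})" "(\<Sum>i<n. x i * x i) = 1"
      by (auto simp: PiE_iff)
    moreover from this have "x i = 0" if "i \<ge> n" for i
      using that by (auto dest: spec[of _ i])
    ultimately show "x \<in> ?S" by auto
  qed
  finally show ?thesis .
qed

text \<open>The quadratic form is continuous, so it attains its maximum on the compact sphere;
  homogeneity of degree two carries the bound over to all vectors.\<close>

lemma rayleigh_quotient_attains_max:
  fixes A :: "real mat"
  assumes A: "A \<in> carrier_mat n n" and n: "n > 0"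
  obtains x \<mu> where "x \<in> carrier_vec n" "x \<noteq> 0\<^sub>v n" "x \<bullet> (A *\<^sub>v x) = \<mu> * (x \<bullet> x)"
    "\<And>y. y \<in> carrier_vec n \<Longrightarrow> y \<bullet> (A *\<^sub>v y) \<le> \<mu> * (y \<bullet> y)"
proof -
  define S where "S = {x :: nat \<Rightarrow> real. (\<forall>i\<ge>n. x i = 0) \<and> (\<Sum>i<n. x i * x i) = 1}"
  define q where "q x = (\<Sum>i<n. x i * (\<Sum>j<n. A $$ (i, j) * x j))" for x
  have q: "vec n x \<bullet> (A *\<^sub>v vec n x) = q x" for x
    using A by (simp add: q_def scalar_prod_def atLeast0LessThan)
  \<comment> \<open>The first unit vector witnesses that the sphere is nonempty; it exists because
    \<open>n > 0\<close>.\<close>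
  have "(\<lambda>i. of_bool (i = 0)) \<in> S"
    using n by (auto simp: S_def of_bool_def if_distrib sum.delta cong: if_cong)
  then have "S \<noteq> {}" by blast
  moreover have "continuous_on UNIV q"
    unfolding q_def by (intro continuous_intros) auto
  then have "continuous_on S q"
    by (rule continuous_on_subset) auto
  moreover have "compact S"
    unfolding S_def by (rule compact_sphere)
  ultimately obtain x where x: "x \<in> S" and max: "\<And>y. y \<in> S \<Longrightarrow> q y \<le> q x"
    using continuous_attains_sup by metis
  have x1: "vec n x \<bullet> vec n x = 1"
    using x by (simp add: S_def scalar_prod_def atLeast0LessThan)
  show thesis
  proof (rule that)
    show "vec n x \<noteq> 0\<^sub>v n" using x1 by (metis scalar_prod_left_zero vec_carrier zero_neq_one)
    show "vec n x \<bullet> (A *\<^sub>v vec n x) = q x * (vec n x \<bullet> vec n x)"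
      by (simp only: x1 q mult_1_right)
    fix y :: "real vec" assume y: "y \<in> carrier_vec n"
    show "y \<bullet> (A *\<^sub>v y) \<le> q x * (y \<bullet> y)"
    proof (cases "y = 0\<^sub>v n")
      case True
      then show ?thesis using A by simp
    next
      case False
      define c where "c = 1 / sqrt (y \<bullet> y)"
      have pos: "y \<bullet> y > 0" using scalar_prod_self_pos[OF y False] .
      then have c: "c * c * (y \<bullet> y) = 1"
        by (simp add: c_def)
      \<comment> \<open>Membership in \<open>S\<close> requires zeros from \<open>n\<close> on,
        whereas \<open>y $ i\<close> is unspecified there; hence the cut-off.\<close>
      let ?z = "\<lambda>i. if i < n then c * y $ i else 0"
      have z: "vec n ?z = c \<cdot>\<^sub>v y" using y by auto
      have "(\<Sum>i<n. ?z i * ?z i) = (c \<cdot>\<^sub>v y) \<bullet> (c \<cdot>\<^sub>v y)"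
        using y by (auto simp: scalar_prod_def atLeast0LessThan intro!: sum.cong)
      also have "\<dots> = 1" using y c by simp
      finally have "?z \<in> S" by (auto simp: S_def)
      from max[OF this] have "(c \<cdot>\<^sub>v y) \<bullet> (A *\<^sub>v (c \<cdot>\<^sub>v y)) \<le> q x"
        by (simp only: q[symmetric] z)
      then have "c * c * (y \<bullet> (A *\<^sub>v y)) \<le> q x"
        using A y by (simp add: mult_mat_vec[OF A y])
      then have "(y \<bullet> y) * (c * c * (y \<bullet> (A *\<^sub>v y))) \<le> (y \<bullet> y) * q x"
        using pos by (intro mult_left_mono) auto
      moreover have "(y \<bullet> y) * (c * c * (y \<bullet> (A *\<^sub>v y))) = y \<bullet> (A *\<^sub>v y)"
        using c by (simp add: mult_ac)
      ultimately show ?thesis by (simp add: mult.commute)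
    qed
  qed auto
qed

text \<open>With \<open>w = \<mu> x - A x\<close>, the nonnegative form \<open>\<mu> \<bar>y\<bar>\<^sup>2 - y\<^sup>T A y\<close> at \<open>y = x + t w\<close> is
  \<open>2 t \<bar>w\<bar>\<^sup>2 + O(t\<^sup>2)\<close>, which is negative for small \<open>t < 0\<close> unless \<open>w = 0\<close>.\<close>

lemma rayleigh_quotient_maximizer_eigen:
  fixes A :: "real mat"
  assumes A: "A \<in> carrier_mat n n" and sym: "A\<^sup>T = A"
    and max: "\<And>y. y \<in> carrier_vec n \<Longrightarrow> y \<bullet> (A *\<^sub>v y) \<le> \<mu> * (y \<bullet> y)"
    and x: "x \<in> carrier_vec n" and eq: "x \<bullet> (A *\<^sub>v x) = \<mu> * (x \<bullet> x)"
  shows "A *\<^sub>v x = \<mu> \<cdot>\<^sub>v x"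
proof -
  define w where "w = \<mu> \<cdot>\<^sub>v x - A *\<^sub>v x"
  have Ax: "A *\<^sub>v x \<in> carrier_vec n" using A x by auto
  have w: "w \<in> carrier_vec n" using A x by (auto simp: w_def)
  have Aw: "A *\<^sub>v w \<in> carrier_vec n" using A w by auto
  \<comment> \<open>Symmetry of \<open>A\<close> makes the two mixed terms of the form at
    \<open>x + t w\<close> equal.\<close>
  have xAw: "x \<bullet> (A *\<^sub>v w) = w \<bullet> (A *\<^sub>v x)"
    using transpose_vec_mult_scalar[OF A w x] comm_scalar_prod[OF w Ax] by (simp add: sym)
  have ww: "w \<bullet> w = \<mu> * (w \<bullet> x) - w \<bullet> (A *\<^sub>v x)"
    using w x Ax scalar_prod_minus_distrib[of w n "\<mu> \<cdot>\<^sub>v x" "A *\<^sub>v x"]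
    by (simp add: w_def[symmetric])
  define d where "d = \<mu> * (w \<bullet> w) - w \<bullet> (A *\<^sub>v w)"
  have key: "0 \<le> 2 * t * (w \<bullet> w) + t * t * d" for t
  proof -
    let ?y = "x + t \<cdot>\<^sub>v w"
    have tw: "t \<cdot>\<^sub>v w \<in> carrier_vec n" using w by auto
    have y: "?y \<in> carrier_vec n" using x tw by auto
    have Ay: "A *\<^sub>v ?y = A *\<^sub>v x + t \<cdot>\<^sub>v (A *\<^sub>v w)"
      using mult_add_distrib_mat_vec[OF A x tw] mult_mat_vec[OF A w] by simp
    have "?y \<bullet> ?y = x \<bullet> x + 2 * t * (w \<bullet> x) + t * t * (w \<bullet> w)"
      using x w tw comm_scalar_prod[OF x w]
      by (simp add: add_scalar_prod_distrib[of _ n] scalar_prod_add_distrib[of _ n] algebra_simps)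
    moreover have "?y \<bullet> (A *\<^sub>v ?y) = x \<bullet> (A *\<^sub>v x) + 2 * t * (w \<bullet> (A *\<^sub>v x)) + t * t * (w \<bullet> (A *\<^sub>v w))"
      unfolding Ay using x w tw Ax Aw xAw
      by (simp add: add_scalar_prod_distrib[of _ n] scalar_prod_add_distrib[of _ n] algebra_simps)
    ultimately have "x \<bullet> (A *\<^sub>v x) + 2 * t * (w \<bullet> (A *\<^sub>v x)) + t * t * (w \<bullet> (A *\<^sub>v w))
        \<le> \<mu> * (x \<bullet> x + 2 * t * (w \<bullet> x) + t * t * (w \<bullet> w))"
      using max[OF y] by simp
    then have "0 \<le> 2 * t * (\<mu> * (w \<bullet> x) - w \<bullet> (A *\<^sub>v x)) + t * t * d"
      unfolding d_def eq by (simp add: algebra_simps)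
    then show ?thesis by (simp only: ww)
  qed
  have "w \<bullet> w = 0"
  proof (rule ccontr)
    assume "w \<bullet> w \<noteq> 0"
    then have pos: "w \<bullet> w > 0"
      using scalar_prod_self_eq_0_iff[OF w] scalar_prod_self_pos[OF w] by auto
    \<comment> \<open>\<open>D\<close> is a strictly positive bound for \<open>d\<close>. At
      \<open>t = -(w \<bullet> w) / D\<close> the quadratic term is at most half the size of the
      negative linear term, so \<open>key\<close> fails.\<close>
    define D where "D = \<bar>d\<bar> + 1"
    have D: "D > 0" "d \<le> D" by (auto simp: D_def)
    let ?t = "- (w \<bullet> w) / D"
    have "?t * ?t * d \<le> ?t * ?t * D"
      by (rule mult_left_mono[OF D(2)]) simp
    also have "\<dots> = (w \<bullet> w) * (w \<bullet> w) / D" using D by simp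
    finally have "0 \<le> 2 * ?t * (w \<bullet> w) + (w \<bullet> w) * (w \<bullet> w) / D"
      using key[of ?t] by linarith
    then have "(w \<bullet> w) * (w \<bullet> w) / D \<le> 0" by simp
    moreover have "(w \<bullet> w) * (w \<bullet> w) / D > 0" using pos D by simp
    ultimately show False by linarith
  qed
  then have "w = 0\<^sub>v n" using scalar_prod_self_eq_0_iff[OF w] by simp
  then have "(\<mu> \<cdot>\<^sub>v x - A *\<^sub>v x) $ i = 0" if "i < n" for i
    using that by (simp add: w_def[symmetric])
  then show ?thesis using A x by (intro eq_vecI) auto
qed

section \<open>Eigenvectors of a matrix dominated by a nonnegative one\<close>

text \<open>Triangle inequality in row \<open>i\<close> of \<open>C z = k z\<close>. The general
  scalar field covers two uses: a real signed matrix \<open>C\<close>, and the complexification of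
  \<open>B\<close> itself.\<close>

lemma norm_eigenvector_subharmonic:
  fixes C :: "'a :: real_normed_field mat" and B :: "real mat"
  assumes C: "C \<in> carrier_mat n n" and B: "B \<in> carrier_mat n n"
    and le: "\<forall>i<n. \<forall>j<n. norm (C $$ (i, j)) \<le> B $$ (i, j)"
    and ev: "eigenvector C z k" and i: "i < n"
  shows "norm k * norm (z $ i) \<le> (B *\<^sub>v map_vec norm z) $ i"
proof -
  have z: "z \<in> carrier_vec n" and Cz: "C *\<^sub>v z = k \<cdot>\<^sub>v z"
    using ev C by (auto simp: eigenvector_def)
  have "norm k * norm (z $ i) = norm ((C *\<^sub>v z) $ i)"
    using z i by (simp add: Cz norm_mult)
  also have "\<dots> = norm (\<Sum>j<n. C $$ (i, j) * z $ j)"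
    using mult_mat_vec_index_sum[OF C z i] by simp
  also have "\<dots> \<le> (\<Sum>j<n. norm (C $$ (i, j)) * norm (z $ j))"
    using norm_sum by (simp add: norm_mult[symmetric])
  also have "\<dots> \<le> (\<Sum>j<n. B $$ (i, j) * norm (z $ j))"
    by (intro sum_mono mult_right_mono) (use le i in auto)
  also have "\<dots> = (B *\<^sub>v map_vec norm z) $ i"
    using mult_mat_vec_index_sum[OF B, of "map_vec norm z" i] z i by simp
  finally show ?thesis .
qed

text \<open>Weighting the rowwise inequality by the nonnegative numbers \<open>norm (z $ i)\<close>
  and summing shows that the Rayleigh quotient of \<open>B\<close> at the vector of moduli is at
  least \<open>norm k\<close>.\<close>

lemma norm_eigenvector_quadratic_form:
  fixes C :: "'a :: real_normed_field mat" and B :: "real mat"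
  assumes C: "C \<in> carrier_mat n n" and B: "B \<in> carrier_mat n n"
    and le: "\<forall>i<n. \<forall>j<n. norm (C $$ (i, j)) \<le> B $$ (i, j)"
    and ev: "eigenvector C z k"
  shows "norm k * (map_vec norm z \<bullet> map_vec norm z) \<le> map_vec norm z \<bullet> (B *\<^sub>v map_vec norm z)"
proof -
  let ?y = "map_vec norm z"
  have z: "z \<in> carrier_vec n" using ev C by (auto simp: eigenvector_def)
  have "norm k * (?y \<bullet> ?y) = (\<Sum>i<n. norm (z $ i) * (norm k * norm (z $ i)))"
    using z by (simp add: scalar_prod_sum[of _ n] sum_distrib_left mult_ac)
  also have "\<dots> \<le> (\<Sum>i<n. norm (z $ i) * (B *\<^sub>v ?y) $ i)"
    by (intro sum_mono mult_left_mono norm_eigenvector_subharmonic[OF C B le ev]) auto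
  also have "\<dots> = ?y \<bullet> (B *\<^sub>v ?y)"
    using z B by (simp add: scalar_prod_sum[of _ n])
  finally show ?thesis .
qed

lemma map_vec_norm_nonzero:
  fixes z :: "'a :: real_normed_field vec"
  assumes "z \<in> carrier_vec n" "z \<noteq> 0\<^sub>v n"
  shows "map_vec norm z \<noteq> 0\<^sub>v n"
proof
  assume "map_vec norm z = 0\<^sub>v n"
  then have "map_vec norm z $ i = 0" if "i < n" for i using that by simp
  with assms(1) have "z = 0\<^sub>v n" by auto
  with assms(2) show False by simp
qed

section \<open>Perron-Frobenius theory for symmetric nonnegative matrices\<close>

text \<open>The maximum \<open>\<mu>\<close> of the Rayleigh quotient is an eigenvalue. Comparing
  the complexification of \<open>B\<close> with \<open>B\<close> bounds the modulus of every complex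
  eigenvalue by \<open>\<mu>\<close>; hence \<open>\<mu>\<close> is the spectral radius, and all
  four claims can be read off.\<close>

lemma spectral_radius_symmetric_nonneg:
  fixes B :: "real mat"
  assumes B: "B \<in> carrier_mat n n" and n: "n > 0" and sym: "B\<^sup>T = B"
    and nonneg: "\<forall>i<n. \<forall>j<n. 0 \<le> B $$ (i, j)"
  shows "eigenvalue B (real_spectral_radius B)"
    and "\<And>y. y \<in> carrier_vec n \<Longrightarrow> y \<bullet> (B *\<^sub>v y) \<le> real_spectral_radius B * (y \<bullet> y)"
    and "\<And>k. eigenvalue B k \<Longrightarrow> \<bar>k\<bar> \<le> real_spectral_radius B"
    and "0 \<le> real_spectral_radius B"
proof -
  let ?C = "map_mat complex_of_real B"
  have C: "?C \<in> carrier_mat n n" using B by simp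
  obtain x \<mu> where x: "x \<in> carrier_vec n" "x \<noteq> 0\<^sub>v n" and eq: "x \<bullet> (B *\<^sub>v x) = \<mu> * (x \<bullet> x)"
    and max: "\<And>y. y \<in> carrier_vec n \<Longrightarrow> y \<bullet> (B *\<^sub>v y) \<le> \<mu> * (y \<bullet> y)"
    using rayleigh_quotient_attains_max[OF B n] by metis
  have "B *\<^sub>v x = \<mu> \<cdot>\<^sub>v x"
    by (rule rayleigh_quotient_maximizer_eigen[OF B sym max x(1) eq])
  with x B have ev: "eigenvalue B \<mu>" by (auto simp: eigenvalue_def eigenvector_def)
  \<comment> \<open>Eigenvalues are roots of the characteristic polynomial, which commutes with the
    embedding of the reals.\<close>
  have lift: "eigenvalue ?C (complex_of_real k)" if "eigenvalue B k" for k
    using that eigenvalue_root_char_poly[OF B] eigenvalue_root_char_poly[OF C]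
    by (simp add: of_real_hom.char_poly_hom[OF B])
  have bound: "norm k \<le> \<mu>" if k: "eigenvalue ?C k" for k
  proof -
    obtain z where z: "eigenvector ?C z k" using k by (auto simp: eigenvalue_def)
    let ?y = "map_vec norm z"
    have zc: "z \<in> carrier_vec n" "z \<noteq> 0\<^sub>v n" using z C by (auto simp: eigenvector_def)
    have y: "?y \<in> carrier_vec n" using zc by simp
    have "norm k * (?y \<bullet> ?y) \<le> ?y \<bullet> (B *\<^sub>v ?y)"
      by (rule norm_eigenvector_quadratic_form[OF C B _ z]) (use B nonneg in auto)
    also have "\<dots> \<le> \<mu> * (?y \<bullet> ?y)" by (rule max[OF y])
    finally show ?thesis
      using scalar_prod_self_pos[OF y map_vec_norm_nonzero[OF zc]] by simp
  qed
  \<comment> \<open>Applying the bound to \<open>\<mu>\<close> itself yields its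
    nonnegativity.\<close>
  have "\<bar>\<mu>\<bar> \<le> \<mu>" using bound[OF lift[OF ev]] by simp
  have "real_spectral_radius B \<in> norm ` spectrum ?C"
    unfolding real_spectral_radius_def by (rule spectral_radius_mem_max(1)[OF C n])
  then have "real_spectral_radius B \<le> \<mu>"
    using bound by (auto simp: spectrum_def)
  moreover have ge: "\<bar>k\<bar> \<le> real_spectral_radius B" if "eigenvalue B k" for k
    unfolding real_spectral_radius_def
    by (rule spectral_radius_mem_max(2)[OF C n], rule image_eqI[of _ _ "complex_of_real k"])
      (use lift[OF that] in \<open>auto simp: spectrum_def\<close>)
  ultimately have "real_spectral_radius B = \<mu>" using ge[OF ev] by linarith
  with ev max ge \<open>\<bar>\<mu>\<bar> \<le> \<mu>\<close> show "eigenvalue B (real_spectral_radius B)"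
    "\<And>y. y \<in> carrier_vec n \<Longrightarrow> y \<bullet> (B *\<^sub>v y) \<le> real_spectral_radius B * (y \<bullet> y)"
    "\<And>k. eigenvalue B k \<Longrightarrow> \<bar>k\<bar> \<le> real_spectral_radius B"
    "0 \<le> real_spectral_radius B" by auto
qed

text \<open>For a square matrix this is strong connectivity of the digraph of nonzero entries. The
  form by cuts fits both uses: it is tested on the zero set of an eigenvector and verified from
  edges leaving a vertex set.\<close>

definition irreducible_mat :: "real mat \<Rightarrow> bool" where
  "irreducible_mat B \<longleftrightarrow>
    (\<forall>W. W \<noteq> {} \<and> W \<subset> {..<dim_row B} \<longrightarrow> (\<exists>i\<in>W. \<exists>j\<in>{..<dim_row B} - W. B $$ (i, j) \<noteq> 0))"

text \<open>At an index \<open>a\<close> with \<open>y $ a = 0\<close> the eigenvalue equation reads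
  as a vanishing sum of nonnegative terms, so row \<open>a\<close> of \<open>B\<close> is zero
  wherever \<open>y\<close> is positive. By irreducibility the zero set, not being everything, must
  then be empty.\<close>

lemma nonneg_eigenvector_pos:
  fixes B :: "real mat"
  assumes B: "B \<in> carrier_mat n n" and irr: "irreducible_mat B"
    and nonneg: "\<forall>i<n. \<forall>j<n. 0 \<le> B $$ (i, j)"
    and ev: "eigenvector B y k" and y: "\<And>i. i < n \<Longrightarrow> 0 \<le> y $ i" and i: "i < n"
  shows "0 < y $ i"
proof -
  have yc: "y \<in> carrier_vec n" "y \<noteq> 0\<^sub>v n" and By: "B *\<^sub>v y = k \<cdot>\<^sub>v y"
    using ev B by (auto simp: eigenvector_def)
  define W where "W = {i. i < n \<and> y $ i = 0}"
  have "W = {}"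
  proof (rule ccontr)
    assume "W \<noteq> {}"
    moreover have "W \<noteq> {..<n}"
    proof
      assume "W = {..<n}"
      then have "\<forall>i<n. y $ i = 0" by (auto simp: W_def)
      then have "y = 0\<^sub>v n" using yc(1) by auto
      with yc(2) show False by simp
    qed
    moreover have "W \<subseteq> {..<n}" by (auto simp: W_def)
    ultimately have "\<exists>i\<in>W. \<exists>j\<in>{..<n} - W. B $$ (i, j) \<noteq> 0"
      using irr B unfolding irreducible_mat_def by (simp add: psubset_eq)
    then obtain a b where a: "a \<in> W" and b: "b < n" "b \<notin> W" and nz: "B $$ (a, b) \<noteq> 0"
      by auto
    have an: "a < n" "y $ a = 0" using a by (auto simp: W_def)
    have "(\<Sum>j<n. B $$ (a, j) * y $ j) = (B *\<^sub>v y) $ a"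
      using mult_mat_vec_index_sum[OF B yc(1) an(1)] by simp
    also have "\<dots> = 0" using an yc by (simp add: By)
    finally have "B $$ (a, b) * y $ b = 0"
      using b an nonneg y by (subst (asm) sum_nonneg_eq_0_iff) auto
    with nz b show False by (auto simp: W_def)
  qed
  with i y[OF i] show ?thesis by (auto simp: W_def order_less_le)
qed

text \<open>This is the equality case of Wielandt's comparison theorem for symmetric
  \<open>B\<close>, at the eigenvalue \<rho> itself. The right-hand side is
  \<open>C = S B S\<close>, written entrywise with \<open>S\<close> the diagonal matrix of
  \<open>s\<close>.\<close>

lemma eigenvalue_spectral_radius_iff_signature_similar:
  fixes B C :: "real mat"
  assumes B: "B \<in> carrier_mat n n" and C: "C \<in> carrier_mat n n" and n: "n > 0"
    and sym: "B\<^sup>T = B" and irr: "irreducible_mat B"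
    and le: "\<forall>i<n. \<forall>j<n. \<bar>C $$ (i, j)\<bar> \<le> B $$ (i, j)"
  shows "eigenvalue C (real_spectral_radius B) \<longleftrightarrow>
    (\<exists>s. (\<forall>i<n. s i \<in> {-1, 1}) \<and> (\<forall>i<n. \<forall>j<n. C $$ (i, j) = s i * s j * B $$ (i, j)))"
    (is "?L \<longleftrightarrow> ?R")
proof
  have nonneg: "\<forall>i<n. \<forall>j<n. 0 \<le> B $$ (i, j)"
    using le by (meson abs_ge_zero order_trans)
  note \<rho> = spectral_radius_symmetric_nonneg[OF B n sym nonneg]
  let ?\<rho> = "real_spectral_radius B"
  {
    assume ?L
    then obtain x where x: "eigenvector C x ?\<rho>" by (auto simp: eigenvalue_def)
    have xc: "x \<in> carrier_vec n" "x \<noteq> 0\<^sub>v n" and Cx: "C *\<^sub>v x = ?\<rho> \<cdot>\<^sub>v x"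
      using x C by (auto simp: eigenvector_def)
    define y where "y = map_vec norm x"
    have yi: "y $ i = \<bar>x $ i\<bar>" if "i < n" for i using that xc by (simp add: y_def)
    have y: "y \<in> carrier_vec n" "y \<noteq> 0\<^sub>v n"
      using xc map_vec_norm_nonzero[OF xc] by (auto simp: y_def)
    have "?\<rho> * (y \<bullet> y) \<le> y \<bullet> (B *\<^sub>v y)"
      using norm_eigenvector_quadratic_form[OF C B _ x] le \<rho>(4) by (simp add: y_def)
    with \<rho>(2)[OF y(1)] have "y \<bullet> (B *\<^sub>v y) = ?\<rho> * (y \<bullet> y)" by simp
    with B sym \<rho>(2) y(1) have By: "B *\<^sub>v y = ?\<rho> \<cdot>\<^sub>v y"
      by (rule rayleigh_quotient_maximizer_eigen)
    then have evy: "eigenvector B y ?\<rho>" using y B by (auto simp: eigenvector_def)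
    have pos: "0 < y $ i" if "i < n" for i
      by (rule nonneg_eigenvector_pos[OF B irr nonneg evy _ that]) (auto simp: yi)
    \<comment> \<open>Positivity of \<open>y\<close> means that no entry of \<open>x\<close>
      vanishes, so each sign is \<open>1\<close> or \<open>-1\<close>.\<close>
    define s where "s i = sgn (x $ i)" for i
    have s: "s i \<in> {-1, 1}" "s i * x $ i = y $ i" "x $ i = s i * y $ i" if "i < n" for i
      using pos[OF that] yi[OF that] by (auto simp: s_def sgn_if split: if_splits)
    have "C $$ (i, j) = s i * s j * B $$ (i, j)" if i: "i < n" and j: "j < n" for i j
    proof -
      \<comment> \<open>The domination hypothesis makes every bracket nonnegative. Since
        \<open>s j * y $ j = x $ j\<close>, the weighted sum is the difference of the two eigenvalue
        equations in row \<open>i\<close> and vanishes; the positive weights then force each bracket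
        to be zero.\<close>
      have "(\<Sum>j<n. (B $$ (i, j) - s i * s j * C $$ (i, j)) * y $ j)
        = (\<Sum>j<n. B $$ (i, j) * y $ j) - s i * (\<Sum>j<n. C $$ (i, j) * x $ j)"
        unfolding sum_distrib_left sum_subtractf[symmetric]
        by (intro sum.cong) (auto simp: s(3) algebra_simps)
      also have "\<dots> = (B *\<^sub>v y) $ i - s i * (C *\<^sub>v x) $ i"
        using mult_mat_vec_index_sum[OF B y(1) i] mult_mat_vec_index_sum[OF C xc(1) i] by simp
      also have "\<dots> = 0"
        using i y xc s(2)[OF i] by (simp add: By Cx)
      finally have sum0: "(\<Sum>j<n. (B $$ (i, j) - s i * s j * C $$ (i, j)) * y $ j) = 0" .
      have ge: "0 \<le> B $$ (i, j) - s i * s j * C $$ (i, j)" if "j < n" for j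
        using s(1)[OF i] s(1)[OF that] le[rule_format, OF i that] by auto
      have "0 \<le> (B $$ (i, j) - s i * s j * C $$ (i, j)) * y $ j" if "j < n" for j
        using ge[OF that] pos[OF that] by (intro mult_nonneg_nonneg) auto
      then have "(B $$ (i, j) - s i * s j * C $$ (i, j)) * y $ j = 0"
        using sum_nonneg_0[OF _ _ sum0] j by auto
      with pos[OF j] have "B $$ (i, j) = s i * s j * C $$ (i, j)" by simp
      then show ?thesis using s(1)[OF i] s(1)[OF j] by auto
    qed
    with s(1) show ?R by (intro exI[of _ s]) auto
  next
    assume ?R
    then obtain s :: "nat \<Rightarrow> real" where s: "\<And>i. i < n \<Longrightarrow> s i \<in> {-1, 1}"
      and CB: "\<And>i j. i < n \<Longrightarrow> j < n \<Longrightarrow> C $$ (i, j) = s i * s j * B $$ (i, j)" by blast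
    obtain x where x: "eigenvector B x ?\<rho>" using \<rho>(1) by (auto simp: eigenvalue_def)
    have xc: "x \<in> carrier_vec n" "x \<noteq> 0\<^sub>v n" and Bx: "B *\<^sub>v x = ?\<rho> \<cdot>\<^sub>v x"
      using x B by (auto simp: eigenvector_def)
    \<comment> \<open>\<open>y = S x\<close> carries the eigenvector of \<open>B\<close> to one of
      \<open>C = S B S\<close>, because \<open>S\<close> squares to the identity.\<close>
    define y where "y = vec n (\<lambda>i. s i * x $ i)"
    have y: "y \<in> carrier_vec n" by (simp add: y_def)
    have ss: "s i * s i = 1" if "i < n" for i using s[OF that] by auto
    have "C *\<^sub>v y = ?\<rho> \<cdot>\<^sub>v y"
    proof (rule eq_vecI)
      fix i assume "i < dim_vec (?\<rho> \<cdot>\<^sub>v y)"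
      then have i: "i < n" using y by simp
      have "(C *\<^sub>v y) $ i = (\<Sum>j<n. C $$ (i, j) * y $ j)"
        by (rule mult_mat_vec_index_sum[OF C y i])
      also have "\<dots> = (\<Sum>j<n. s i * (B $$ (i, j) * x $ j) * (s j * s j))"
        by (intro sum.cong) (auto simp: CB i y_def)
      also have "\<dots> = s i * (\<Sum>j<n. B $$ (i, j) * x $ j)"
        by (simp add: ss sum_distrib_left)
      also have "\<dots> = s i * (B *\<^sub>v x) $ i"
        using mult_mat_vec_index_sum[OF B xc(1) i] by simp
      also have "\<dots> = (?\<rho> \<cdot>\<^sub>v y) $ i" using i xc by (simp add: Bx y_def)
      finally show "(C *\<^sub>v y) $ i = (?\<rho> \<cdot>\<^sub>v y) $ i" .
    qed (use C y in auto)
    moreover have "y \<noteq> 0\<^sub>v n"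
    proof
      assume "y = 0\<^sub>v n"
      then have "s i * x $ i = 0" if "i < n" for i
        using that by (metis index_vec index_zero_vec(1) y_def)
      with ss have "\<forall>i<n. x $ i = 0" by (metis mult_eq_0_iff zero_neq_one)
      then have "x = 0\<^sub>v n" using xc(1) by auto
      with xc(2) show False by simp
    qed
    ultimately show ?L using C y by (auto simp: eigenvalue_def eigenvector_def)
  }
qed

section \<open>Incidence balance in terms of vertex signs\<close>

lemma orientation_cases:
  assumes "oriented_hypergraph V E \<sigma>" "e \<in> E" "v \<in> e"
  obtains "\<sigma> (e, v) = 1" | "\<sigma> (e, v) = -1"
  using assms by (auto simp: oriented_hypergraph_def incidences_def)

lemma orientation_mult_cases:
  assumes "oriented_hypergraph V E \<sigma>" "e \<in> E" "u \<in> e" "v \<in> e"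
  shows "\<sigma> (e, u) * \<sigma> (e, v) = 1 \<or> \<sigma> (e, u) * \<sigma> (e, v) = -1"
  using orientation_cases[OF assms(1,2,3)] orientation_cases[OF assms(1,2,4)]
  by (metis mult_1 mult_minus1 minus_minus)

text \<open>The bipartition is encoded by a sign \<open>s\<close> on vertices. The choice between
  the two alternatives at an edge is one common sign, which cancels in products of two incidences of
  that edge.\<close>

lemma incidence_balanced_iff_sign:
  assumes "oriented_hypergraph V E \<sigma>"
  shows "incidence_balanced V E \<sigma> \<longleftrightarrow>
    (\<exists>s. (\<forall>v\<in>V. s v \<in> {-1, 1 :: real}) \<and>
      (\<forall>e\<in>E. \<forall>u\<in>e. \<forall>v\<in>e. \<sigma> (e, u) * \<sigma> (e, v) = s u * s v))"
    (is "_ \<longleftrightarrow> (\<exists>s. ?R s)")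
proof
  have sub: "e \<subseteq> V" if "e \<in> E" for e
    using assms that by (auto simp: oriented_hypergraph_def hypergraph_def)
  {
    assume "incidence_balanced V E \<sigma>"
    then obtain X Y where XY: "X \<union> Y = V" "X \<inter> Y = {}" and bal: "\<And>e. e \<in> E \<Longrightarrow>
        (\<forall>v\<in>e \<inter> X. \<sigma> (e, v) = 1) \<and> (\<forall>v\<in>e \<inter> Y. \<sigma> (e, v) = -1) \<or>
        (\<forall>v\<in>e \<inter> X. \<sigma> (e, v) = -1) \<and> (\<forall>v\<in>e \<inter> Y. \<sigma> (e, v) = 1)"
      unfolding incidence_balanced_def by metis
    let ?s = "\<lambda>v. if v \<in> X then 1 else -1 :: real"
    have "\<sigma> (e, u) * \<sigma> (e, v) = ?s u * ?s v" if e: "e \<in> E" and "u \<in> e" "v \<in> e" for e u v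
      using bal[OF e]
    proof (elim disjE conjE)
      assume "\<forall>v\<in>e \<inter> X. \<sigma> (e, v) = 1" "\<forall>v\<in>e \<inter> Y. \<sigma> (e, v) = -1"
      then have "\<sigma> (e, w) = ?s w" if "w \<in> e" for w using that sub[OF e] XY by auto
      then show ?thesis using that by simp
    next
      assume "\<forall>v\<in>e \<inter> X. \<sigma> (e, v) = -1" "\<forall>v\<in>e \<inter> Y. \<sigma> (e, v) = 1"
      then have "\<sigma> (e, w) = - ?s w" if "w \<in> e" for w using that sub[OF e] XY by auto
      then show ?thesis using that by simp
    qed
    then have "?R ?s" by (intro conjI ballI) (simp, assumption)
    then show "\<exists>s. ?R s" by (rule exI[of _ ?s])
  next
    assume "\<exists>s. ?R s"
    then obtain s where R: "?R s" by (rule exE)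
    then have s: "s v \<in> {-1, 1}" if "v \<in> V" for v using that by blast
    have eq: "\<sigma> (e, u) * \<sigma> (e, v) = s u * s v" if "e \<in> E" "u \<in> e" "v \<in> e" for e u v
      using R that by blast
    let ?X = "{v \<in> V. s v = 1}" and ?Y = "{v \<in> V. s v = -1}"
    have "(\<forall>v\<in>e \<inter> ?X. \<sigma> (e, v) = 1) \<and> (\<forall>v\<in>e \<inter> ?Y. \<sigma> (e, v) = -1) \<or>
        (\<forall>v\<in>e \<inter> ?X. \<sigma> (e, v) = -1) \<and> (\<forall>v\<in>e \<inter> ?Y. \<sigma> (e, v) = 1)" if e: "e \<in> E" for e
    proof (cases "e = {}")
      case False
      then obtain u where u: "u \<in> e" by blast
      \<comment> \<open>\<open>c\<close> tells which alternative holds at \<open>e\<close>: on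
        \<open>e\<close> the orientation agrees with \<open>s\<close> if \<open>c = 1\<close> and
        with its negative if \<open>c = -1\<close>. It is read off at an arbitrary vertex of
        \<open>e\<close>; an empty edge satisfies both alternatives vacuously.\<close>
      define c where "c = \<sigma> (e, u) * s u"
      have "u \<in> V" using sub[OF e] u by blast
      then have "c = 1 \<or> c = -1"
        using s[of u] by (cases rule: orientation_cases[OF assms e u]) (auto simp: c_def)
      moreover have "\<sigma> (e, v) = c * s v" if v: "v \<in> e" for v
        using eq[OF e u v] by (cases rule: orientation_cases[OF assms e u]) (simp_all add: c_def)
      ultimately show ?thesis
      proof (elim disjE)
        assume "c = 1" and "\<And>v. v \<in> e \<Longrightarrow> \<sigma> (e, v) = c * s v"
        then show ?thesis by simp
      next
        assume "c = -1" and "\<And>v. v \<in> e \<Longrightarrow> \<sigma> (e, v) = c * s v"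
        then show ?thesis by simp
      qed
    qed simp
    then have *: "\<forall>e\<in>E. (\<forall>v\<in>e \<inter> ?X. \<sigma> (e, v) = 1) \<and> (\<forall>v\<in>e \<inter> ?Y. \<sigma> (e, v) = -1) \<or>
        (\<forall>v\<in>e \<inter> ?X. \<sigma> (e, v) = -1) \<and> (\<forall>v\<in>e \<inter> ?Y. \<sigma> (e, v) = 1)" by (rule ballI)
    have "?X \<union> ?Y = V" "?X \<inter> ?Y = {}" using s by auto
    then show "incidence_balanced V E \<sigma>"
      unfolding incidence_balanced_def by (intro exI[of _ ?X] exI[of _ ?Y] conjI *)
  }
qed

section \<open>Adjacency entries and sign switching\<close>

lemma adjacency_entry_eq_sum:
  assumes "u \<noteq> v"
  shows "adjacency_entry E \<sigma> u v = (\<Sum>e | e \<in> E \<and> u \<in> e \<and> v \<in> e. \<sigma> (e, u) * \<sigma> (e, v))"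
proof (cases "adjacent E u v")
  case False
  then have no_edge: "{e. e \<in> E \<and> u \<in> e \<and> v \<in> e} = {}" by (auto simp: adjacent_def)
  show ?thesis unfolding adjacency_entry_def no_edge using False by simp
qed (simp add: adjacency_entry_def assms)

lemma adjacency_entry_refl [simp]: "adjacency_entry E \<sigma> v v = 0"
  by (simp add: adjacency_entry_def)

lemma adjacency_entry_commute: "adjacency_entry E \<sigma> u v = adjacency_entry E \<sigma> v u"
  by (auto simp: adjacency_entry_def adjacent_def mult.commute intro!: sum.cong)

lemma adjacency_entry_all_positive:
  "u \<noteq> v \<Longrightarrow> adjacency_entry E all_positive u v = real (card {e \<in> E. u \<in> e \<and> v \<in> e})"
  by (simp add: adjacency_entry_eq_sum all_positive_def)

lemma abs_adjacency_entry_le: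
  assumes "oriented_hypergraph V E \<sigma>"
  shows "\<bar>adjacency_entry E \<sigma> u v\<bar> \<le> adjacency_entry E all_positive u v"
proof (cases "u = v")
  case False
  have "\<bar>\<Sum>e | e \<in> E \<and> u \<in> e \<and> v \<in> e. \<sigma> (e, u) * \<sigma> (e, v)\<bar>
    \<le> (\<Sum>e | e \<in> E \<and> u \<in> e \<and> v \<in> e. \<bar>\<sigma> (e, u) * \<sigma> (e, v)\<bar>)"
    by (rule sum_abs)
  also have "\<dots> = (\<Sum>e | e \<in> E \<and> u \<in> e \<and> v \<in> e. 1)"
  proof (intro sum.cong refl)
    fix e assume "e \<in> {e. e \<in> E \<and> u \<in> e \<and> v \<in> e}"
    then show "\<bar>\<sigma> (e, u) * \<sigma> (e, v)\<bar> = 1"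
      using orientation_mult_cases[OF assms, of e u v] by auto
  qed
  finally show ?thesis
    using False by (simp add: adjacency_entry_eq_sum all_positive_def)
qed simp

lemma oriented_hypergraph_finite_edges:
  assumes "oriented_hypergraph V E \<sigma>"
  shows "finite E"
  using assms by (auto simp: oriented_hypergraph_def hypergraph_def intro: finite_subset[of E "Pow V"])

text \<open>Multiplied by \<open>a * b\<close>, the equation says that the sum of
  \<open>1 - a * b * (\<sigma> (e, u) * \<sigma> (e, v))\<close> over the common edges is zero. Each
  term is 0 or 2, so no cancellation can occur and every term vanishes.\<close>

lemma adjacency_entry_switch_iff:
  assumes ori: "oriented_hypergraph V E \<sigma>" and uv: "u \<noteq> v" and ab: "a \<in> {-1, 1}" "b \<in> {-1, 1}"
  shows "adjacency_entry E \<sigma> u v = a * b * adjacency_entry E all_positive u v \<longleftrightarrow>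
    (\<forall>e\<in>E. u \<in> e \<longrightarrow> v \<in> e \<longrightarrow> \<sigma> (e, u) * \<sigma> (e, v) = a * b)"
proof -
  let ?F = "{e. e \<in> E \<and> u \<in> e \<and> v \<in> e}"
  let ?g = "\<lambda>e. 1 - a * b * (\<sigma> (e, u) * \<sigma> (e, v))"
  have fin: "finite ?F" using oriented_hypergraph_finite_edges[OF ori] by simp
  have "adjacency_entry E \<sigma> u v = a * b * adjacency_entry E all_positive u v
    \<longleftrightarrow> adjacency_entry E all_positive u v - a * b * adjacency_entry E \<sigma> u v = 0"
    using ab by auto
  also have "adjacency_entry E all_positive u v - a * b * adjacency_entry E \<sigma> u v = sum ?g ?F"
    using uv by (simp add: adjacency_entry_eq_sum all_positive_def sum_subtractf sum_distrib_left)
  also have "sum ?g ?F = 0 \<longleftrightarrow> (\<forall>e\<in>?F. ?g e = 0)"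
  proof (rule sum_nonneg_eq_0_iff[OF fin])
    fix e assume "e \<in> ?F"
    then show "0 \<le> ?g e" using orientation_mult_cases[OF ori, of e u v] ab by auto
  qed
  also have "\<dots> \<longleftrightarrow> (\<forall>e\<in>?F. \<sigma> (e, u) * \<sigma> (e, v) = a * b)"
    using ab by (intro ball_cong) auto
  finally show ?thesis by auto
qed

text \<open>Distinct vertices are handled by \<open>adjacency_entry_switch_iff\<close> with
  \<open>a = s u\<close> and \<open>b = s v\<close>. For \<open>u = v\<close> both conditions hold:
  the adjacency entries are 0, and squares of signs are 1.\<close>

lemma incidence_balanced_iff_adjacency_switch:
  assumes ori: "oriented_hypergraph V E \<sigma>"
  shows "incidence_balanced V E \<sigma> \<longleftrightarrow>
    (\<exists>s. (\<forall>v\<in>V. s v \<in> {-1, 1 :: real}) \<and>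
      (\<forall>u\<in>V. \<forall>v\<in>V. adjacency_entry E \<sigma> u v = s u * s v * adjacency_entry E all_positive u v))"
proof -
  have sub: "e \<subseteq> V" if "e \<in> E" for e
    using ori that by (auto simp: oriented_hypergraph_def hypergraph_def)
  have "(\<forall>e\<in>E. \<forall>u\<in>e. \<forall>v\<in>e. \<sigma> (e, u) * \<sigma> (e, v) = s u * s v) \<longleftrightarrow>
    (\<forall>u\<in>V. \<forall>v\<in>V. adjacency_entry E \<sigma> u v = s u * s v * adjacency_entry E all_positive u v)"
    (is "?A \<longleftrightarrow> ?B") if s: "\<forall>v\<in>V. s v \<in> {-1, 1}" for s :: "'a \<Rightarrow> real"
  proof
    assume A: ?A
    show ?B
    proof (intro ballI)
      fix u v assume "u \<in> V" "v \<in> V"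
      then show "adjacency_entry E \<sigma> u v = s u * s v * adjacency_entry E all_positive u v"
        using A s adjacency_entry_switch_iff[OF ori, of u v "s u" "s v"] by (cases "u = v") simp_all
    qed
  next
    assume B: ?B
    show ?A
    proof (intro ballI)
      fix e u v assume e: "e \<in> E" "u \<in> e" "v \<in> e"
      then have V: "u \<in> V" "v \<in> V" using sub by auto
      show "\<sigma> (e, u) * \<sigma> (e, v) = s u * s v"
      proof (cases "u = v")
        case True
        then show ?thesis using s V by (cases rule: orientation_cases[OF ori e(1,2)]) auto
      next
        case False
        then show ?thesis
          using B e V s adjacency_entry_switch_iff[OF ori False, of "s u" "s v"] by blast
      qed
    qed
  qed
  then show ?thesis
    unfolding incidence_balanced_iff_sign[OF ori] by (intro ex_cong1 conj_cong refl)
qed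

section \<open>Connectivity and edges across a vertex cut\<close>

text \<open>If no edge left \<open>W\<close>, then "being a vertex of \<open>W\<close> or an edge
  meeting \<open>W\<close>" would propagate along walks, and no walk could lead from
  \<open>W\<close> to a vertex outside it.\<close>

lemma connected_hypergraph_cut:
  assumes conn: "connected_hypergraph V E" and W: "W \<noteq> {}" "W \<subset> V"
  shows "\<exists>e\<in>E. \<exists>u\<in>e. \<exists>v\<in>e. u \<in> W \<and> v \<notin> W"
proof (rule ccontr)
  assume "\<not> ?thesis"
  then have closed: "v \<in> W" if "e \<in> E" "u \<in> e" "v \<in> e" "u \<in> W" for e u v
    using that by blast
  define P where "P = (\<lambda>x. case x of Inl v \<Rightarrow> v \<in> W | Inr e \<Rightarrow> e \<in> E \<and> e \<inter> W \<noteq> {})"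
  have step: "P y" if "P x" "incident x y" "y \<in> V <+> E" for x y
  proof (cases x)
    case (Inl v)
    with that obtain e where "y = Inr e" "e \<in> E" "v \<in> e" by (cases y) auto
    with that(1) Inl show ?thesis by (auto simp: P_def)
  next
    case (Inr e)
    with that(2) obtain v where "y = Inl v" "v \<in> e" by (cases y) auto
    moreover from that(1) Inr obtain u where "e \<in> E" "u \<in> e" "u \<in> W" by (auto simp: P_def)
    ultimately show ?thesis using closed[of e u v] by (simp add: P_def)
  qed
  have "P (last p)" if "p \<noteq> []" "set p \<subseteq> V <+> E" "successively incident p" "P (hd p)" for p
    using that
  proof (induction p)
    case (Cons x p)
    then show ?case using step by (cases p) auto
  qed simp
  then have reach: "P (last p)" if "walk V E p" "P (hd p)" for p
    using that by (auto simp: walk_def)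
  obtain a b where ab: "a \<in> W" "a \<in> V" "b \<in> V" "b \<notin> W" using W by blast
  then have "Inl a \<in> V <+> E" "Inl b \<in> V <+> E" by auto
  then obtain p where "walk V E p" "hd p = Inl a" "last p = Inl b"
    using conn unfolding connected_hypergraph_def by blast
  with ab show False using reach[of p] by (simp add: P_def)
qed

section \<open>The matrices of an oriented hypergraph\<close>

lemma vertex_degree_eq_card:
  "vertex_degree E v = card {e \<in> E. v \<in> e}"
proof -
  have "{i \<in> incidences E. snd i = v} = (\<lambda>e. (e, v)) ` {e \<in> E. v \<in> e}"
    by (auto simp: incidences_def)
  then show ?thesis by (simp add: vertex_degree_def card_image inj_on_def)
qed

lemma adjacency_matrix_carrier [simp]:
  "adjacency_matrix vs E \<sigma> \<in> carrier_mat (length vs) (length vs)"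
  by (simp add: adjacency_matrix_def)

lemma laplacian_matrix_carrier [simp]:
  "laplacian_matrix vs E \<sigma> \<in> carrier_mat (length vs) (length vs)"
  by (simp add: laplacian_matrix_def adjacency_matrix_def degree_matrix_def)

lemma adjacency_matrix_index:
  "i < length vs \<Longrightarrow> j < length vs \<Longrightarrow>
    adjacency_matrix vs E \<sigma> $$ (i, j) = adjacency_entry E \<sigma> (vs ! i) (vs ! j)"
  by (simp add: adjacency_matrix_def)

lemma laplacian_matrix_index:
  "i < length vs \<Longrightarrow> j < length vs \<Longrightarrow> laplacian_matrix vs E \<sigma> $$ (i, j) =
    (if i = j then real (vertex_degree E (vs ! i)) else adjacency_entry E \<sigma> (vs ! i) (vs ! j))"
  by (simp add: laplacian_matrix_def degree_matrix_def adjacency_matrix_def mat_diag_def)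

text \<open>An entry of the Gram matrix sums the sign products over the edges containing both
  vertices. On the diagonal the products are 1 and count the degree; off it, distinctness of
  \<open>vs\<close> turns distinct positions into distinct vertices.\<close>

lemma incidence_matrix_gram:
  assumes ori: "oriented_hypergraph V E \<sigma>" and vs: "distinct vs" and es: "distinct es" "set es = E"
  shows "(incidence_matrix vs es \<sigma>)\<^sup>T * incidence_matrix vs es \<sigma> = laplacian_matrix vs E \<sigma>"
proof (rule eq_matI)
  let ?M = "incidence_matrix vs es \<sigma>"
  fix i j assume "i < dim_row (laplacian_matrix vs E \<sigma>)" "j < dim_col (laplacian_matrix vs E \<sigma>)"
  then have ij: "i < length vs" "j < length vs"
    by (simp_all add: laplacian_matrix_def adjacency_matrix_def)
  let ?u = "vs ! i" and ?v = "vs ! j"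
  let ?f = "\<lambda>e. (if ?u \<in> e then \<sigma> (e, ?u) else 0) * (if ?v \<in> e then \<sigma> (e, ?v) else 0)"
  have fin: "finite E" using es by auto
  have "(?M\<^sup>T * ?M) $$ (i, j) = (\<Sum>k<length es. ?f (es ! k))"
    using ij by (simp add: incidence_matrix_def scalar_prod_def atLeast0LessThan)
  \<comment> \<open>As \<open>es\<close> is duplicate-free, positions correspond bijectively to
    edges.\<close>
  also have "\<dots> = sum ?f E"
    by (rule sum.reindex_bij_betw) (use es in \<open>auto intro: bij_betw_nth\<close>)
  also have "\<dots> = (\<Sum>e | e \<in> E \<and> ?u \<in> e \<and> ?v \<in> e. \<sigma> (e, ?u) * \<sigma> (e, ?v))"
    using fin by (intro sum.mono_neutral_cong_right) auto
  also have "\<dots> = laplacian_matrix vs E \<sigma> $$ (i, j)"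
  proof (cases "i = j")
    case True
    have "(\<Sum>e | e \<in> E \<and> ?u \<in> e. \<sigma> (e, ?u) * \<sigma> (e, ?u)) = (\<Sum>e | e \<in> E \<and> ?u \<in> e. 1)"
      by (intro sum.cong) (auto elim!: orientation_cases[OF ori])
    then show ?thesis using ij True by (simp add: laplacian_matrix_index vertex_degree_eq_card)
  next
    case False
    then have "?u \<noteq> ?v" using vs ij by (simp add: nth_eq_iff_index_eq)
    then show ?thesis using ij False by (simp add: laplacian_matrix_index adjacency_entry_eq_sum)
  qed
  finally show "(?M\<^sup>T * ?M) $$ (i, j) = laplacian_matrix vs E \<sigma> $$ (i, j)" .
qed (auto simp: incidence_matrix_def laplacian_matrix_def adjacency_matrix_def)

text \<open>Transfers the vertex signs to positions in \<open>vs\<close>, giving the form in which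
  the matrix comparison produces them.\<close>

lemma incidence_balanced_iff_signature_similar:
  assumes ori: "oriented_hypergraph V E \<sigma>" and vs: "distinct vs" "set vs = V"
  shows "incidence_balanced V E \<sigma> \<longleftrightarrow>
    (\<exists>s. (\<forall>i<length vs. s i \<in> {-1, 1 :: real}) \<and>
      (\<forall>i<length vs. \<forall>j<length vs.
        adjacency_matrix vs E \<sigma> $$ (i, j) = s i * s j * adjacency_matrix vs E all_positive $$ (i, j)))"
    (is "_ \<longleftrightarrow> (\<exists>s. ?R s)")
  unfolding incidence_balanced_iff_adjacency_switch[OF ori]
proof
  assume "\<exists>s. (\<forall>v\<in>V. s v \<in> {-1, 1 :: real}) \<and>
      (\<forall>u\<in>V. \<forall>v\<in>V. adjacency_entry E \<sigma> u v = s u * s v * adjacency_entry E all_positive u v)"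
  then obtain s where "\<forall>v\<in>V. s v \<in> {-1, 1 :: real}"
    "\<forall>u\<in>V. \<forall>v\<in>V. adjacency_entry E \<sigma> u v = s u * s v * adjacency_entry E all_positive u v" by blast
  then have "?R (\<lambda>i. s (vs ! i))"
    using vs(2) nth_mem by (fastforce simp: adjacency_matrix_index)
  then show "\<exists>s. ?R s" by (rule exI[of _ "\<lambda>i. s (vs ! i)"])
next
  assume "\<exists>s. ?R s"
  then obtain s where s: "?R s" by blast
  \<comment> \<open>\<open>g\<close> maps a vertex to its position in \<open>vs\<close>, so signs on
    positions pull back to vertices.\<close>
  define g where "g = the_inv_into {..<length vs} ((!) vs)"
  have bij: "bij_betw ((!) vs) {..<length vs} V" using vs by (auto intro: bij_betw_nth)
  have g: "g v < length vs" "vs ! g v = v" if "v \<in> V" for v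
    using bij that bij_betw_the_inv_into[OF bij] f_the_inv_into_f_bij_betw[OF bij]
    by (auto simp: g_def bij_betw_def)
  show "\<exists>s. (\<forall>v\<in>V. s v \<in> {-1, 1 :: real}) \<and>
      (\<forall>u\<in>V. \<forall>v\<in>V. adjacency_entry E \<sigma> u v = s u * s v * adjacency_entry E all_positive u v)"
  proof (intro exI[of _ "\<lambda>v. s (g v)"] conjI ballI)
    fix u v assume uv: "u \<in> V" "v \<in> V"
    have "adjacency_matrix vs E \<sigma> $$ (g u, g v) =
        s (g u) * s (g v) * adjacency_matrix vs E all_positive $$ (g u, g v)"
      using s g(1)[OF uv(1)] g(1)[OF uv(2)] by blast
    then show "adjacency_entry E \<sigma> u v = s (g u) * s (g v) * adjacency_entry E all_positive u v"
      using g[OF uv(1)] g[OF uv(2)] by (simp add: adjacency_matrix_index)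
  qed (use s g in auto)
qed

text \<open>A cut of the positions is a cut of the vertices, and some edge crosses it. With all
  signs positive an off-diagonal entry counts common edges, hence is nonzero there. The two matrices
  agree off the diagonal, where all crossing entries lie.\<close>

lemma irreducible_adjacency_laplacian:
  assumes ori: "oriented_hypergraph V E \<sigma>" and conn: "connected_hypergraph V E"
    and vs: "distinct vs" "set vs = V"
  shows "irreducible_mat (adjacency_matrix vs E all_positive)" (is ?A)
    and "irreducible_mat (laplacian_matrix vs E all_positive)" (is ?L)
proof -
  let ?n = "length vs"
  have "\<exists>i\<in>W. \<exists>j\<in>{..<?n} - W. adjacency_entry E all_positive (vs ! i) (vs ! j) \<noteq> 0"
    if W: "W \<noteq> {}" "W \<subset> {..<?n}" for W
  proof -
    have bij: "bij_betw ((!) vs) {..<?n} V" using vs by (auto intro: bij_betw_nth)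
    then have inj: "inj_on ((!) vs) {..<?n}" and V: "(!) vs ` {..<?n} = V" by (auto simp: bij_betw_def)
    have "(!) vs ` W \<subset> V" using image_strict_mono[OF inj W(2)] V by simp
    then obtain e u v where e: "e \<in> E" "u \<in> e" "v \<in> e" and u: "u \<in> (!) vs ` W" and v: "v \<notin> (!) vs ` W"
      using connected_hypergraph_cut[OF conn] W(1) by (metis image_is_empty)
    have "v \<in> V" using ori e by (auto simp: oriented_hypergraph_def hypergraph_def)
    then obtain j where j: "j < ?n" "v = vs ! j" using V by blast
    obtain i where i: "i \<in> W" "u = vs ! i" using u by blast
    have "finite {e \<in> E. u \<in> e \<and> v \<in> e}" using oriented_hypergraph_finite_edges[OF ori] by simp
    then have "card {e \<in> E. u \<in> e \<and> v \<in> e} \<noteq> 0" using e by (auto simp: card_eq_0_iff)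
    moreover have "u \<noteq> v" using u v by blast
    ultimately have "adjacency_entry E all_positive u v \<noteq> 0"
      by (simp add: adjacency_entry_all_positive)
    moreover have "j \<notin> W" using v j by blast
    ultimately show ?thesis using i j by blast
  qed
  note cut = this
  have "\<exists>i\<in>W. \<exists>j\<in>{..<?n} - W.
      adjacency_matrix vs E all_positive $$ (i, j) \<noteq> 0 \<and> laplacian_matrix vs E all_positive $$ (i, j) \<noteq> 0"
    if W: "W \<noteq> {}" "W \<subset> {..<?n}" for W
  proof -
    obtain i j where ij: "i \<in> W" "j \<in> {..<?n} - W"
      "adjacency_entry E all_positive (vs ! i) (vs ! j) \<noteq> 0" using cut[OF W] by blast
    moreover have "i < ?n" "j < ?n" "i \<noteq> j" using ij W by auto
    ultimately show ?thesis
      by (intro bexI[of _ i] bexI[of _ j]) (auto simp: adjacency_matrix_index laplacian_matrix_index)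
  qed
  then show ?A ?L
    unfolding irreducible_mat_def
      carrier_matD(1)[OF adjacency_matrix_carrier] carrier_matD(1)[OF laplacian_matrix_carrier]
    by blast+
qed

lemma adjacency_matrix_symmetric: "(adjacency_matrix vs E \<sigma>)\<^sup>T = adjacency_matrix vs E \<sigma>"
  by (rule eq_matI) (auto simp: adjacency_matrix_def intro: adjacency_entry_commute)

lemma laplacian_matrix_symmetric: "(laplacian_matrix vs E \<sigma>)\<^sup>T = laplacian_matrix vs E \<sigma>"
  by (rule eq_matI)
    (auto simp: laplacian_matrix_def degree_matrix_def adjacency_matrix_def mat_diag_def
      intro: adjacency_entry_commute)

section \<open>Eigenvalue and singular value criteria for balance\<close>

lemma incidence_balanced_iff_adjacency_eigenvalue:
  assumes ori: "oriented_hypergraph V E \<sigma>" and V: "V \<noteq> {}" and conn: "connected_hypergraph V E"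
    and vs: "distinct vs" "set vs = V"
  shows "incidence_balanced V E \<sigma> \<longleftrightarrow>
    eigenvalue (adjacency_matrix vs E \<sigma>) (real_spectral_radius (adjacency_matrix vs E all_positive))"
  unfolding incidence_balanced_iff_signature_similar[OF ori vs]
  by (rule eigenvalue_spectral_radius_iff_signature_similar[symmetric])
    (use V vs irreducible_adjacency_laplacian[OF ori conn vs] abs_adjacency_entry_le[OF ori] in
      \<open>auto simp: adjacency_matrix_symmetric adjacency_matrix_index\<close>)

lemma incidence_balanced_iff_laplacian_eigenvalue:
  assumes ori: "oriented_hypergraph V E \<sigma>" and V: "V \<noteq> {}" and conn: "connected_hypergraph V E"
    and vs: "distinct vs" "set vs = V"
  shows "incidence_balanced V E \<sigma> \<longleftrightarrow>
    eigenvalue (laplacian_matrix vs E \<sigma>) (real_spectral_radius (laplacian_matrix vs E all_positive))"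
proof -
  \<comment> \<open>Conjugation by a signature fixes the diagonal, since
    \<open>s i * s i = 1\<close>, and off the diagonal the two matrices coincide. So the same
    \<open>s\<close> serves both.\<close>
  have switch: "adjacency_matrix vs E \<sigma> $$ (i, j) = s i * s j * adjacency_matrix vs E all_positive $$ (i, j)
      \<longleftrightarrow> laplacian_matrix vs E \<sigma> $$ (i, j) = s i * s j * laplacian_matrix vs E all_positive $$ (i, j)"
    if "i < length vs" "j < length vs" "\<forall>i<length vs. s i \<in> {-1, 1}" for s i j
    using that by (cases "i = j") (auto simp: adjacency_matrix_index laplacian_matrix_index)
  have "incidence_balanced V E \<sigma> \<longleftrightarrow> (\<exists>s. (\<forall>i<length vs. s i \<in> {-1, 1 :: real}) \<and>
      (\<forall>i<length vs. \<forall>j<length vs.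
        laplacian_matrix vs E \<sigma> $$ (i, j) = s i * s j * laplacian_matrix vs E all_positive $$ (i, j)))"
    unfolding incidence_balanced_iff_signature_similar[OF ori vs]
    using switch by (intro ex_cong1 conj_cong refl) blast
  also have "\<dots> \<longleftrightarrow>
    eigenvalue (laplacian_matrix vs E \<sigma>) (real_spectral_radius (laplacian_matrix vs E all_positive))"
    by (rule eigenvalue_spectral_radius_iff_signature_similar[symmetric])
      (use V vs irreducible_adjacency_laplacian[OF ori conn vs] abs_adjacency_entry_le[OF ori] in
        \<open>auto simp: laplacian_matrix_symmetric laplacian_matrix_index\<close>)
  finally show ?thesis .
qed

text \<open>Singular values are the square roots of the eigenvalues of \<open>L\<close>, whose
  largest is its spectral radius by the Perron-Frobenius facts. Finiteness of the spectrum makes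
  \<open>Max\<close> a genuine maximum.\<close>

lemma max_singular_value_eq_sqrt:
  assumes gram: "M\<^sup>T * M = L" and L: "L \<in> carrier_mat n n" "n > 0" "L\<^sup>T = L"
    and nonneg: "\<forall>i<n. \<forall>j<n. 0 \<le> L $$ (i, j)"
  shows "max_singular_value M = sqrt (real_spectral_radius L)"
  unfolding max_singular_value_def
proof (rule Max_eqI)
  note \<rho> = spectral_radius_symmetric_nonneg[OF L nonneg]
  have sv: "s \<in> singular_values M \<longleftrightarrow> 0 \<le> s \<and> eigenvalue L (s\<^sup>2)" for s
    by (simp add: singular_values_def gram)
  have "singular_values M \<subseteq> sqrt ` spectrum L"
  proof
    fix s assume "s \<in> singular_values M"
    then have "s = sqrt (s\<^sup>2)" "s\<^sup>2 \<in> spectrum L" by (auto simp: sv spectrum_def)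
    then show "s \<in> sqrt ` spectrum L" by (rule image_eqI)
  qed
  then show "finite (singular_values M)"
    using card_finite_spectrum(1)[OF L(1)] by (rule finite_surj[rotated])
  show "sqrt (real_spectral_radius L) \<in> singular_values M"
    using \<rho>(1,4) by (simp add: sv)
  show "s \<le> sqrt (real_spectral_radius L)" if "s \<in> singular_values M" for s
    using that \<rho>(3)[of "s\<^sup>2"] by (auto simp: sv intro: real_le_rsqrt)
qed

theorem theorem3p5:
  fixes V :: "'a set" and E :: "'a set set" and \<sigma> :: "'a set \<times> 'a \<Rightarrow> real"
    and vs :: "'a list" and es :: "'a set list"
  assumes "oriented_hypergraph V E \<sigma>"
    and "V \<noteq> {}"
    and "connected_hypergraph V E"
    and "distinct vs" and "set vs = V"
    and "distinct es" and "set es = E"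
  shows "(incidence_balanced V E \<sigma> \<longleftrightarrow>
            max_singular_value (incidence_matrix vs es all_positive)
              \<in> singular_values (incidence_matrix vs es \<sigma>))
       \<and> (incidence_balanced V E \<sigma> \<longleftrightarrow>
            eigenvalue (laplacian_matrix vs E \<sigma>)
              (real_spectral_radius (laplacian_matrix vs E all_positive)))
       \<and> (incidence_balanced V E \<sigma> \<longleftrightarrow>
            eigenvalue (adjacency_matrix vs E \<sigma>)
              (real_spectral_radius (adjacency_matrix vs E all_positive)))"
proof -
  note lap = incidence_balanced_iff_laplacian_eigenvalue[OF assms(1-5)]
  note gram = incidence_matrix_gram[OF _ assms(4,6,7)]
  let ?L = "laplacian_matrix vs E all_positive"
  have ori: "oriented_hypergraph V E all_positive"
    using assms(1) by (simp add: oriented_hypergraph_def all_positive_def)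
  have n: "length vs > 0" using assms(2,5) by auto
  have nonneg: "\<forall>i<length vs. \<forall>j<length vs. 0 \<le> ?L $$ (i, j)"
    using order_trans[OF abs_ge_zero abs_adjacency_entry_le[OF ori]] by (auto simp: laplacian_matrix_index)
  note L = laplacian_matrix_carrier n laplacian_matrix_symmetric nonneg
  \<comment> \<open>The left side asks whether the square of
    \<open>sqrt (real_spectral_radius ?L)\<close> is an eigenvalue of the Gram matrix of the signed
    incidence matrix, that is, of its Laplacian. Nonnegativity of the spectral radius lets the
    square undo the root.\<close>
  have "max_singular_value (incidence_matrix vs es all_positive) \<in> singular_values (incidence_matrix vs es \<sigma>)
    \<longleftrightarrow> eigenvalue (laplacian_matrix vs E \<sigma>) (real_spectral_radius ?L)"
    using spectral_radius_symmetric_nonneg(4)[OF L]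
    by (simp add: max_singular_value_eq_sqrt[OF gram[OF ori] L] singular_values_def gram[OF assms(1)])
  with lap incidence_balanced_iff_adjacency_eigenvalue[OF assms(1-5)] show ?thesis by blast
qed

end
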